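(* Let $X$ be a metrizable Priestley space. Then $X$ is not an Esakia space if and only if one of $Z_1, Z_2, Z_3$ is a forbidden configuration for $X$; that is, if and only if there exist $i\in\{1,2,3\}$, a map $e\colon Z_i\to X$ that is both a topological embedding and an order embedding, and an open neighborhood $U$ of $e(y)$ in $X$ such that $e^{-1}({\downarrow}U)=\{x,y\}$.
   Context: For a poset $X$ and $A\subseteq X$, let ${\downarrow}A=\{x\in X\mid x\le a\text{ for some }a\in A\}$ and ${\uparrow}A=\{x\in X\mid a\le x\text{ for some }a\in A\}$; $A$ is an upset if ${\uparrow}A=A$ and a downset if ${\downarrow}A=A$. A Priestley space is a compact topological space $X$ equipped with a partial order $\le$ such that whenever $x\nleq y$ there is a clopen upset $U$ with $x\in U$ and $y\notin U$. It is metrizable if its underlying topological space is metrizable. An Esakia space is a Priestley space in which the downset of each open set is open (equivalently, the downset of each clopen set is clopen). The Priestley spaces $Z_1,Z_2,Z_3$ have the same underlying topological space: the one-point compactification of the countable discrete space $\{y\}\cup\{z_n\mid n\in\omega\}$ (with $y$ and all $z_n$ pairwise distinct), where $x$ is the added point (so $x$ is the limit of the sequence $(z_n)$ and $y$ is isolated). Their partial orders are as follows, with only the listed strict relations holding. - $Z_1$: $x<y$; $z_0>z_1>z_2>\cdots$ (i.e. $z_m<z_n$ iff $m>n$); $x<z_n$ for all $n$ (so $y$ is incomparable with every $z_n$). - $Z_2$: $x<y$ and $x<z_n$ for all $n$ (so $\{y\}\cup\{z_n\mid n\in\omega\}$ is an antichain). - $Z_3$: $x<y$ only. *)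

theory Defs
  imports "HOL-Analysis.Analysis"
begin

definition downset_of :: "'a rel \<Rightarrow> 'a set \<Rightarrow> 'a set" where
  "downset_of r A = {x. \<exists>a\<in>A. (x, a) \<in> r}"

definition upset_of :: "'a rel \<Rightarrow> 'a set \<Rightarrow> 'a set" where
  "upset_of r A = {x. \<exists>a\<in>A. (a, x) \<in> r}"

definition is_upset :: "'a rel \<Rightarrow> 'a set \<Rightarrow> bool" where
  "is_upset r A \<longleftrightarrow> upset_of r A = A"

(* A pair (x, y) in r means "x is below or equal to y".  The order lives on the carrier
   of the topology, and partial_order_on includes r \<subseteq> topspace X \<times> topspace X. *)
definition Priestley_space :: "'a topology \<Rightarrow> 'a rel \<Rightarrow> bool" where
  "Priestley_space X r \<longleftrightarrow>
     compact_space X \<and> partial_order_on (topspace X) r \<and>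
     (\<forall>x\<in>topspace X. \<forall>y\<in>topspace X. (x, y) \<notin> r \<longrightarrow>
        (\<exists>U. openin X U \<and> closedin X U \<and> is_upset r U \<and> x \<in> U \<and> y \<notin> U))"

definition Esakia_space :: "'a topology \<Rightarrow> 'a rel \<Rightarrow> bool" where
  "Esakia_space X r \<longleftrightarrow>
     Priestley_space X r \<and> (\<forall>U. openin X U \<longrightarrow> openin X (downset_of r U))"

definition order_embedding :: "'a set \<Rightarrow> 'a rel \<Rightarrow> 'b rel \<Rightarrow> ('a \<Rightarrow> 'b) \<Rightarrow> bool" where
  "order_embedding A r s f \<longleftrightarrow> (\<forall>p\<in>A. \<forall>q\<in>A. (p, q) \<in> r \<longleftrightarrow> (f p, f q) \<in> s)"

datatype isolated_point = Y | Z nat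

(* The library's one-point compactification of a topology on 'a lives on 'a option,
   and None is the added point. *)
type_synonym Z_point = "isolated_point option"

abbreviation pt_x :: Z_point where "pt_x \<equiv> None"
abbreviation pt_y :: Z_point where "pt_y \<equiv> Some Y"
abbreviation pt_z :: "nat \<Rightarrow> Z_point" where "pt_z n \<equiv> Some (Z n)"

definition Z_topology :: "Z_point topology" where
  "Z_topology = Alexandroff_compactification (discrete_topology (UNIV :: isolated_point set))"

definition Z1_order :: "Z_point rel" where
  "Z1_order = Id \<union> {(pt_x, pt_y)} \<union> {(pt_z m, pt_z n) | m n. m > n} \<union> {(pt_x, pt_z n) | n. True}"

definition Z2_order :: "Z_point rel" where
  "Z2_order = Id \<union> {(pt_x, pt_y)} \<union> {(pt_x, pt_z n) | n. True}"

definition Z3_order :: "Z_point rel" where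
  "Z3_order = Id \<union> {(pt_x, pt_y)}"

(* The three configurations differ only in the order s on the common space Z_topology;
   its carrier is the whole type, so the preimage of a set under e is the plain vimage. *)
definition forbidden_configuration :: "Z_point rel \<Rightarrow> 'a topology \<Rightarrow> 'a rel \<Rightarrow> bool" where
  "forbidden_configuration s X r \<longleftrightarrow>
     (\<exists>e U. embedding_map Z_topology X e \<and>
            order_embedding (topspace Z_topology) s r e \<and>
            openin X U \<and> e pt_y \<in> U \<and>
            e -` downset_of r U = {pt_x, pt_y})"

end

theory Submission
  imports Defs "HOL-Library.Ramsey"
begin

text \<open>
  If \<open>U\<close> is open and \<open>\<down>U\<close> is not, metrizability yields a sequence outside \<open>\<down>U\<close> that converges to
  some \<open>x \<in> \<down>U\<close>, say \<open>x \<le> y \<in> U\<close>. By Ramsey's theorem the sequence may be taken increasing,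
  decreasing, or an antichain whose members are either all above \<open>x\<close> or all not above \<open>x\<close>. The order
  of a Priestley space is closed, so an increasing sequence would lie below \<open>x\<close>, hence inside
  \<open>\<down>U\<close>; the remaining cases are copies of \<open>Z\<^sub>1\<close>, \<open>Z\<^sub>2\<close> and \<open>Z\<^sub>3\<close>. Conversely, the preimage of
  an open downset cannot be the non-open set \<open>{x, y}\<close>.
\<close>

section \<open>Order axioms and closedness of the order\<close>

lemma Priestley_space_refl:
  "Priestley_space X r \<Longrightarrow> x \<in> topspace X \<Longrightarrow> (x, x) \<in> r"
  by (auto simp: Priestley_space_def partial_order_on_def preorder_on_def refl_on_def)

lemma Priestley_space_trans:
  "Priestley_space X r \<Longrightarrow> (x, y) \<in> r \<Longrightarrow> (y, z) \<in> r \<Longrightarrow> (x, z) \<in> r"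
  unfolding Priestley_space_def partial_order_on_def preorder_on_def by (meson transD)

lemma Priestley_space_antisym:
  "Priestley_space X r \<Longrightarrow> (x, y) \<in> r \<Longrightarrow> (y, x) \<in> r \<Longrightarrow> x = y"
  unfolding Priestley_space_def partial_order_on_def by (meson antisymD)

lemma Priestley_space_carrier:
  "Priestley_space X r \<Longrightarrow> r \<subseteq> topspace X \<times> topspace X"
  by (auto simp: Priestley_space_def partial_order_on_def preorder_on_def)

text \<open>A clopen upset separating \<open>x\<close> from \<open>y\<close> contains
  \<open>z n\<close> and misses \<open>w n\<close> for all large \<open>n\<close>, so an upset could
  not have \<open>z n\<close> below \<open>w n\<close> there. Since the relation then fails
  eventually, it is enough to assume it infinitely often.\<close>

lemma Priestley_order_closed:
  assumes P: "Priestley_space X r"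
    and z: "limitin X z x sequentially" and w: "limitin X w y sequentially"
    and freq: "\<exists>\<^sub>F n in sequentially. (z n, w n) \<in> r"
  shows "(x, y) \<in> r"
proof (rule ccontr)
  assume "(x, y) \<notin> r"
  moreover have "x \<in> topspace X" "y \<in> topspace X"
    using z w by (auto simp: limitin_def)
  ultimately obtain W where W: "openin X W" "closedin X W" "is_upset r W" "x \<in> W" "y \<notin> W"
    using P unfolding Priestley_space_def by blast
  have "\<forall>\<^sub>F n in sequentially. z n \<in> W"
    using z W by (auto simp: limitin_def)
  moreover have "\<forall>\<^sub>F n in sequentially. w n \<in> topspace X - W"
    using w W \<open>y \<in> topspace X\<close> unfolding limitin_def by (meson DiffI openin_diff openin_topspace)
  ultimately have "\<forall>\<^sub>F n in sequentially. (z n, w n) \<notin> r"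
    by eventually_elim (use W(3) in \<open>auto simp: is_upset_def upset_of_def\<close>)
  with freq show False
    by (simp add: frequently_def)
qed

section \<open>The common space of the three configurations\<close>

lemma topspace_Z_topology [simp]: "topspace Z_topology = UNIV"
  by (auto simp: Z_topology_def UNIV_option_conv)

lemma openin_Z_topology:
  "openin Z_topology V \<longleftrightarrow> (pt_x \<in> V \<longrightarrow> finite (- V))"
proof (cases "pt_x \<in> V")
  case True
  have "p \<in> - V \<longleftrightarrow> p \<in> Some ` {q. Some q \<notin> V}" for p
    using True by (cases p) auto
  then have "- V = Some ` {q. Some q \<notin> V}"
    by blast
  then have fin: "finite (- V) \<longleftrightarrow> finite {q. Some q \<notin> V}"
    by (simp add: finite_image_iff)
  have "p \<in> V \<longleftrightarrow> p \<in> insert None (Some ` (UNIV - {q. Some q \<notin> V}))" for p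
    using True by (cases p) auto
  then have "V = insert None (Some ` (UNIV - {q. Some q \<notin> V}))"
    by blast
  \<comment> \<open>The compact set in the description of an open neighbourhood of the added point
    is determined by \<open>V\<close>, so the existential over it collapses; compact subsets of a
    discrete space are the finite ones.\<close>
  moreover have "C = {q. Some q \<notin> V}" if "V = insert None (Some ` (UNIV - C))" for C
    unfolding that by auto
  ultimately have "V = insert None (Some ` (UNIV - C)) \<longleftrightarrow> C = {q. Some q \<notin> V}" for C
    by metis
  moreover have "V \<noteq> Some ` U" for U
    using True by auto
  ultimately show ?thesis
    using True fin by (simp add: Z_topology_def openin_Alexandroff_compactification compactin_discrete_topology)
next
  case False
  then have "p \<in> V \<longleftrightarrow> p \<in> Some ` {q. Some q \<in> V}" for p
    by (cases p) auto
  then have "V = Some ` {q. Some q \<in> V}"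
    by blast
  with False show ?thesis
    unfolding Z_topology_def openin_Alexandroff_compactification by auto
qed

lemma compact_space_Z_topology: "compact_space Z_topology"
  by (simp add: Z_topology_def)

fun Z_map :: "'a \<Rightarrow> 'a \<Rightarrow> (nat \<Rightarrow> 'a) \<Rightarrow> Z_point \<Rightarrow> 'a" where
  "Z_map x y z None = x"
| "Z_map x y z (Some Y) = y"
| "Z_map x y z (Some (Z n)) = z n"

lemma Z_point_cases [case_names x y z]:
  obtains "p = pt_x" | "p = pt_y" | n where "p = pt_z n"
  by (metis isolated_point.exhaust option.exhaust)

text \<open>All points but \<open>pt_x\<close> are isolated, so continuity has content only at
  \<open>pt_x\<close>, where convergence of \<open>z\<close> makes the preimage of a neighbourhood
  cofinite.\<close>

lemma continuous_map_Z_map: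
  assumes "limitin X z x sequentially" "y \<in> topspace X" "\<And>n. z n \<in> topspace X"
  shows "continuous_map Z_topology X (Z_map x y z)"
proof -
  have x: "x \<in> topspace X"
    using assms by (auto simp: limitin_def)
  have "finite (- (Z_map x y z -` W))" if "openin X W" "x \<in> W" for W
  proof -
    have "\<forall>\<^sub>F n in sequentially. z n \<in> W"
      using assms(1) that by (auto simp: limitin_def)
    then obtain N where N: "\<And>n. n \<ge> N \<Longrightarrow> z n \<in> W"
      unfolding eventually_sequentially by blast
    have "p \<in> insert pt_y (pt_z ` {..<N})" if "Z_map x y z p \<notin> W" for p
      using that \<open>x \<in> W\<close> N by (cases p rule: Z_point_cases) (force simp: image_iff not_less)+
    then have "- (Z_map x y z -` W) \<subseteq> insert pt_y (pt_z ` {..<N})"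
      by blast
    then show ?thesis
      by (rule finite_subset) simp
  qed
  moreover have "Z_map x y z p \<in> topspace X" for p
    using x assms by (cases p rule: Z_point_cases) auto
  ultimately show ?thesis
    by (auto simp: continuous_map openin_Z_topology vimage_def)
qed

lemma not_open_xy: "\<not> openin Z_topology {pt_x, pt_y}"
proof
  assume "openin Z_topology {pt_x, pt_y}"
  then have "finite (- {pt_x, pt_y})"
    by (simp add: openin_Z_topology)
  moreover have "range pt_z \<subseteq> - {pt_x, pt_y}"
    by auto
  moreover have "infinite (range pt_z)"
    by (rule range_inj_infinite) (simp add: inj_def)
  ultimately show False
    by (meson finite_subset)
qed

section \<open>Forbidden configurations\<close>

lemma forbidden_configuration_imp_not_Esakia:
  assumes "forbidden_configuration s X r"
  shows "\<not> Esakia_space X r"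
proof
  assume E: "Esakia_space X r"
  obtain e U where e: "embedding_map Z_topology X e"
    and U: "openin X U" "e -` downset_of r U = {pt_x, pt_y}"
    using assms by (auto simp: forbidden_configuration_def)
  have "continuous_map Z_topology X e"
    using e by (meson embedding_map_def continuous_map_in_subtopology homeomorphic_imp_continuous_map)
  moreover have "openin X (downset_of r U)"
    using E U by (simp add: Esakia_space_def)
  ultimately have "openin Z_topology (e -` downset_of r U)"
    by (auto simp: continuous_map vimage_def)
  with U not_open_xy show False
    by simp
qed

text \<open>Reduces a configuration to its order relations. Points with equal images are below each
  other in \<open>s\<close>, hence equal by antisymmetry; and a continuous injection from a compact
  space into a Hausdorff space is an embedding.\<close>

lemma forbidden_configurationI:
  assumes "Hausdorff_space X" "limitin X z x sequentially" "openin X U" "y \<in> U"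
    and emb: "order_embedding UNIV s r (Z_map x y z)"
    and s: "antisym s" "refl s"
    and r: "r \<subseteq> topspace X \<times> topspace X"
    and "x \<in> downset_of r U" "\<And>n. z n \<notin> downset_of r U"
  shows "forbidden_configuration s X r"
proof -
  let ?e = "Z_map x y z"
  have e: "(?e p, ?e q) \<in> r \<longleftrightarrow> (p, q) \<in> s" for p q
    using emb by (auto simp: order_embedding_def)
  have car: "?e p \<in> topspace X" for p
    using e[of p p] s(2) r by (auto simp: refl_on_def)
  have "inj ?e"
  proof (rule injI)
    fix p q assume "?e p = ?e q"
    then have "(p, q) \<in> s" "(q, p) \<in> s"
      using e[of p q] e[of q p] e[of p p] s(2) by (auto simp: refl_on_def)
    with s(1) show "p = q"
      by (auto dest: antisymD)
  qed
  moreover have "continuous_map Z_topology X ?e"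
    using car[of pt_y] car[of "pt_z _"] assms(2) by (intro continuous_map_Z_map) auto
  ultimately have "embedding_map Z_topology X ?e"
    using assms(1) by (intro continuous_imp_embedding_map compact_space_Z_topology) auto
  moreover have "y \<in> downset_of r U"
    using e[of pt_y pt_y] s(2) \<open>y \<in> U\<close> by (auto simp: refl_on_def downset_of_def)
  then have "p \<in> ?e -` downset_of r U \<longleftrightarrow> p \<in> {pt_x, pt_y}" for p
    using assms by (cases p rule: Z_point_cases) auto
  then have "?e -` downset_of r U = {pt_x, pt_y}"
    by blast
  ultimately show ?thesis
    unfolding forbidden_configuration_def using assms(3,4) emb
    by (intro exI[of _ ?e] exI[of _ U]) auto
qed

lemma Z_orders_refl_antisym:
  assumes "s \<in> {Z1_order, Z2_order, Z3_order}"
  shows "antisym s" "refl s"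
  using assms by (auto simp: antisym_def refl_on_def Z1_order_def Z2_order_def Z3_order_def)

section \<open>Extraction of sequences\<close>

lemma Ramsey_subsequence:
  fixes c :: "nat \<Rightarrow> nat \<Rightarrow> nat"
  assumes "infinite A" "\<And>m n. c m n < k"
  obtains h :: "nat \<Rightarrow> nat" and t where "strict_mono h" "range h \<subseteq> A" "t < k" "\<And>m n. m < n \<Longrightarrow> c (h m) (h n) = t"
proof -
  \<comment> \<open>Ramsey's theorem colours unordered pairs; \<open>Min\<close> and
    \<open>Max\<close> recover the order of the two indices, and the increasing enumeration
    \<open>h\<close> preserves it.\<close>
  let ?f = "\<lambda>S. c (Min S) (Max S)"
  obtain H t where H: "H \<subseteq> A" "infinite H" "t < k"
    "\<And>m n. m \<in> H \<Longrightarrow> n \<in> H \<Longrightarrow> m \<noteq> n \<Longrightarrow> ?f {m, n} = t"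
    using Ramsey2[of A ?f k] assms by metis
  obtain h :: "nat \<Rightarrow> nat" where h: "strict_mono h" "\<And>n. h n \<in> H"
    using infinite_enumerate[OF H(2)] by blast
  have "c (h m) (h n) = t" if "m < n" for m n
    using H(4)[of "h m" "h n"] h strict_monoD[OF h(1) that] by simp
  with h H show ?thesis
    by (intro that[of h t]) auto
qed

text \<open>The complement of \<open>D\<close> is not closed, so some point of \<open>D\<close> lies
  in its closure; in a metric space such a point is the limit of a sequence from the
  complement.\<close>

lemma metrizable_not_open_sequence:
  assumes "metrizable_space X" "D \<subseteq> topspace X" "\<not> openin X D"
  obtains z x where "x \<in> D" "limitin X z x sequentially" "\<And>n. z n \<in> topspace X - D"
proof -
  obtain M d where M: "Metric_space M d" "X = Metric_space.mtopology M d"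
    using assms(1) by (auto simp: metrizable_space_def)
  have "\<not> closedin X (topspace X - D)"
    using assms by (simp add: openin_closedin)
  then have "\<not> X closure_of (topspace X - D) \<subseteq> topspace X - D"
    using closure_of_subset_eq by blast
  then obtain x where "x \<in> X closure_of (topspace X - D)" "x \<in> D"
    by (meson DiffI closure_of_subset_topspace subset_iff)
  moreover from this obtain z where "range z \<subseteq> (topspace X - D) \<inter> M" "limitin X z x sequentially"
    using Metric_space.closure_of_sequentially[OF M(1), of "topspace X - D"] M(2) by auto
  ultimately show ?thesis
    by (intro that[of x z]) auto
qed

section \<open>A configuration from a downset that is not open\<close>

lemma not_Esakia_imp_forbidden_configuration:
  assumes P: "Priestley_space X r" and met: "metrizable_space X" and "\<not> Esakia_space X r"
  shows "\<exists>s\<in>{Z1_order, Z2_order, Z3_order}. forbidden_configuration s X r"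
proof -
  note refl = Priestley_space_refl[OF P] and trans = Priestley_space_trans[OF P]
    and antisym = Priestley_space_antisym[OF P] and closed = Priestley_order_closed[OF P]
  obtain U where U: "openin X U" "\<not> openin X (downset_of r U)"
    using assms by (auto simp: Esakia_space_def)
  let ?D = "downset_of r U"
  have D_down: "a \<in> ?D" if "(a, b) \<in> r" "b \<in> ?D" for a b
    using that trans by (auto simp: downset_of_def)
  have UD: "U \<subseteq> ?D"
    using refl openin_subset[OF U(1)] by (auto simp: downset_of_def)
  have "?D \<subseteq> topspace X"
    using Priestley_space_carrier[OF P] by (auto simp: downset_of_def)
  then obtain w x where w: "x \<in> ?D" "limitin X w x sequentially" "\<And>n. w n \<in> topspace X - ?D"
    using metrizable_not_open_sequence[OF met _ U(2)] by metis
  obtain y where y: "y \<in> U" "(x, y) \<in> r"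
    using w(1) by (auto simp: downset_of_def)
  have carrier: "x \<in> topspace X" "y \<in> topspace X"
    using y Priestley_space_carrier[OF P] by auto
  \<comment> \<open>Otherwise \<open>U\<close> would be a neighbourhood of the limit
    \<open>x\<close>, and \<open>w\<close> would eventually enter it.\<close>
  have "x \<noteq> y"
  proof
    assume "x = y"
    then have "\<forall>\<^sub>F n in sequentially. w n \<in> U"
      using w(2) U y by (auto simp: limitin_def)
    then show False
      using w(3) UD by (auto simp: eventually_sequentially)
  qed
  then have yx: "(y, x) \<notin> r"
    using y antisym by blast
  have lim_y: "limitin X (\<lambda>_. y) y sequentially"
    using carrier by (simp add: limitin_def)
  \<comment> \<open>In all three orders \<open>pt_y\<close> is below no \<open>pt_z n\<close>, so
    the subsequence is chosen among these indices. If only finitely many were available, closedness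
    of the order would put \<open>y\<close> below \<open>x\<close>.\<close>
  have inf: "infinite {n. (y, w n) \<notin> r}"
  proof
    assume "finite {n. (y, w n) \<notin> r}"
    then have "\<forall>\<^sub>F n in sequentially. (y, w n) \<in> r"
      by (simp add: cofinite_eq_sequentially[symmetric] eventually_cofinite)
    then have "(y, x) \<in> r"
      by (intro closed[OF lim_y w(2)] eventually_frequently) auto
    with yx show False ..
  qed
  \<comment> \<open>For \<open>m < n\<close>, colour 0 stands for increasing and 1 for decreasing;
    incomparable pairs get 2 or 3 according to whether \<open>x\<close> is below the earlier
    term.\<close>
  define c :: "nat \<Rightarrow> nat \<Rightarrow> nat" where "c m n =
    (if (w m, w n) \<in> r then 0 else if (w n, w m) \<in> r then 1 else if (x, w m) \<in> r then 2 else 3)"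
    for m n
  have c4: "c m n < 4" for m n
    by (simp add: c_def)
  obtain h :: "nat \<Rightarrow> nat" and t where h: "strict_mono h" "range h \<subseteq> {n. (y, w n) \<notin> r}"
    and t: "t < 4" "\<And>m n. m < n \<Longrightarrow> c (h m) (h n) = t"
    using Ramsey_subsequence[where c = c, OF inf c4] by blast
  define z where "z = w \<circ> h"
  have z: "limitin X z x sequentially"
    unfolding z_def using w(2) h(1) by (rule limitin_subsequence[rotated])
  have zX: "z n \<in> topspace X" and zD: "z n \<notin> ?D" and yz: "(y, z n) \<notin> r" for n
    using w(3) h(2) by (auto simp: z_def)
  \<comment> \<open>Both \<open>x\<close> and \<open>y\<close> lie in the downset \<open>?D\<close>,
    so anything below either of them would too.\<close>
  have zx: "(z n, x) \<notin> r" and zy: "(z n, y) \<notin> r" for n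
    using D_down[of "z n"] zD w(1) y UD by auto
  have lim_z: "limitin X (\<lambda>_. z m) (z m) sequentially" for m
    using zX by (simp add: limitin_def)
  have later: "\<exists>\<^sub>F n in sequentially. Q n" if "\<And>n. m < n \<Longrightarrow> Q n" for Q and m :: nat
    by (intro eventually_frequently sequentially_bot eventually_mono[OF eventually_gt_at_top[of m]] that)
  have zz: "(z n, z n) \<in> r" for n
    using refl zX by blast
  have zc: "(if (z m, z n) \<in> r then 0 else if (z n, z m) \<in> r then 1
      else if (x, z m) \<in> r then 2 else 3) = t" if "m < n" for m n
    using t(2)[OF that] unfolding c_def z_def o_def .
  have "t \<noteq> 0"
  proof
    assume "t = 0"
    then have "(z 0, z n) \<in> r" if "0 < n" for n
      using zc[OF that] by (auto split: if_splits)
    then have "(z 0, x) \<in> r"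
      by (intro closed[OF lim_z z] later[of 0])
    with zx show False ..
  qed
  then have up: "(z m, z n) \<notin> r" if "m < n" for m n
    using zc[OF that] by auto
  have conf: "forbidden_configuration s X r"
    if "s \<in> {Z1_order, Z2_order, Z3_order}"
      "\<And>p q. (p, q) \<in> s \<longleftrightarrow> (Z_map x y z p, Z_map x y z q) \<in> r" for s
  proof (rule forbidden_configurationI)
    show "order_embedding UNIV s r (Z_map x y z)"
      using that(2) by (simp add: order_embedding_def)
  qed (fact metrizable_imp_Hausdorff_space[OF met] z U(1) y(1) Z_orders_refl_antisym[OF that(1)]
      Priestley_space_carrier[OF P] w(1) zD)+
  \<comment> \<open>These facts settle all pairs except two distinct terms of the sequence, and
    \<open>x\<close> against a term; the value of \<open>t\<close> decides those.\<close>
  note emb = refl[OF carrier(1)] refl[OF carrier(2)] y(2) yx zz zx zy yz \<open>x \<noteq> y\<close>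
  have col: "t = 1 \<and> (z n, z m) \<in> r \<or> t \<noteq> 1 \<and> (z n, z m) \<notin> r \<and> ((x, z m) \<in> r \<longleftrightarrow> t = 2)"
    if "m < n" for m n
    using zc[OF that, symmetric] up[OF that]
    by (cases "(z n, z m) \<in> r"; cases "(x, z m) \<in> r") simp_all
  have one: "(z n, z m) \<in> r" if "t = 1" "m < n" for m n
    using col[OF that(2)] that(1) by blast
  have two: "(z n, z m) \<notin> r" if "t \<noteq> 1" "m < n" for m n
    using col[OF that(2)] that(1) by blast
  \<comment> \<open>Colours 2 and 3 test only the earlier index, and every \<open>m\<close> is the
    earlier index of the pair \<open>m\<close>, \<open>Suc m\<close>.\<close>
  have three: "(x, z m) \<in> r \<longleftrightarrow> t = 2" if "t \<noteq> 1" for m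
    using col[of m "Suc m"] that by blast
  show ?thesis
  proof (cases "t = 1")
    case True
    \<comment> \<open>The terms after \<open>z m\<close> lie below it and converge to
      \<open>x\<close>, so closedness of the order puts \<open>x\<close> below
      \<open>z m\<close>.\<close>
    have xz: "(x, z m) \<in> r" for m
      by (intro closed[OF z lim_z] later[of m] one True)
    have zz_iff: "(z m, z n) \<in> r \<longleftrightarrow> n \<le> m" for m n
      using up[of m n] one[OF True, of n m] zz by (cases m n rule: linorder_cases) auto
    have "(p, q) \<in> Z1_order \<longleftrightarrow> (Z_map x y z p, Z_map x y z q) \<in> r" for p q
      by (cases p rule: Z_point_cases; cases q rule: Z_point_cases)
        (auto simp: emb xz zz_iff Z1_order_def)
    then show ?thesis
      using conf[of Z1_order] by blast
  next
    case False
    have zz_iff: "(z m, z n) \<in> r \<longleftrightarrow> m = n" for m n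
      using up[of m n] two[OF False, of n m] zz by (cases m n rule: linorder_cases) auto
    show ?thesis
    proof (cases "t = 2")
      case True
      have "(p, q) \<in> Z2_order \<longleftrightarrow> (Z_map x y z p, Z_map x y z q) \<in> r" for p q
        by (cases p rule: Z_point_cases; cases q rule: Z_point_cases)
          (auto simp: emb zz_iff three[OF False] True Z2_order_def)
      then show ?thesis
        using conf[of Z2_order] by blast
    next
      case t2: False
      have "(p, q) \<in> Z3_order \<longleftrightarrow> (Z_map x y z p, Z_map x y z q) \<in> r" for p q
        by (cases p rule: Z_point_cases; cases q rule: Z_point_cases)
          (auto simp: emb zz_iff three[OF False] t2 Z3_order_def)
      then show ?thesis
        using conf[of Z3_order] by blast
    qed
  qed
qed

theorem theorem2p2:
  fixes X :: "'a topology" and r :: "'a rel"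
  assumes "Priestley_space X r" and "metrizable_space X"
  shows "\<not> Esakia_space X r \<longleftrightarrow>
           (\<exists>s\<in>{Z1_order, Z2_order, Z3_order}. forbidden_configuration s X r)"
  using not_Esakia_imp_forbidden_configuration[OF assms] forbidden_configuration_imp_not_Esakia
  by blast

end
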